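(* Let an SMR synchronizer satisfy the SMR synchronizer specification (Monotonicity, Validity, Bounded Entry with some constant $d$, Startup, Progress). Then the consensus synchronizer constructed from it as described in the context satisfies the following properties for some view $\mathcal V$: I. For all correct $p_i$ and views $v,v'$: if $\mathbb E_i(v)$ and $\mathbb E_i(v')$ are defined, then $v<v'\iff\mathbb E_i(v)<\mathbb E_i(v')$. II. $\mathbb E_{\rm first}(\mathcal V)\ge\mathsf{GST}$. III. For every correct $p_i$ and every $v\ge\mathcal V$, $\mathbb E_i(v)$ is defined. IV. For all $v\ge\mathcal V$, $\mathbb E_{\rm last}(v)\le\mathbb E_{\rm first}(v)+d$. V. For all $v\ge\mathcal V$, $\mathbb E_{\rm first}(v+1)>\mathbb E_{\rm first}(v)+F(v)$.
   Context: Model. There are $n=3f+1$ processes $p_1,\dots,p_n$; at most $f$ are Byzantine, the others are correct. Partial synchrony: each execution has a time $\mathsf{GST}$ and a duration $\delta$ (unknown to the protocol) such that messages sent between correct processes after $\mathsf{GST}$ are received within $\delta$; before $\mathsf{GST}$ messages can be arbitrarily delayed or lost. Local clocks may drift arbitrarily before $\mathsf{GST}$ and track real time thereafter. SMR synchronizer. Views are $1,2,\dots$; $0$ is the initial invalid view. The synchronizer issues $\mathtt{new\_view}(v)$ at a process (the process enters $v$); processes may call $\mathtt{advance}()$. $E_i(v)$ is the time correct $p_i$ enters $v$; $E_{\rm first}(v),E_{\rm last}(v)$ the earliest/latest such time over correct processes; $A_i(v)$ the time correct $p_i$ calls $\mathtt{advance}$ while in $v$; $A_{\rm first}(v)$ the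 earliest over correct processes (all partial). Specification: (Monotonicity) if $E_i(v),E_i(v')$ are defined then $v<v'\iff E_i(v)<E_i(v')$. (Validity) if $E_i(v+1)$ is defined then $A_{\rm first}(v)$ is defined and $A_{\rm first}(v)<E_i(v+1)$. (Bounded Entry) there are a view $\mathcal V_0$ and $d$ such that for all $v\ge\mathcal V_0$, if $E_{\rm first}(v)$ is defined and it is not the case that $A_{\rm first}(v)<E_{\rm first}(v)+d$, then all correct processes enter $v$ and $E_{\rm last}(v)\le E_{\rm first}(v)+d$. (Startup) if $f+1$ correct processes call $\mathtt{advance}$ in view $0$, then $E_{\rm first}(1)$ is defined. (Progress) if $E_{\rm first}(v)$ is defined and there is a set $P$ of $f+1$ correct processes such that every $p_i\in P$ that enters $v$ eventually calls $\mathtt{advance}$ in $v$, then $E_{\rm first}(v+1)$ is defined. Consensus synchronizer. It issues notifications $\mathtt{new\_consensus\_view}(v)$; $\mathbb E_i(v)$ is the time when correct $p_i$ receives $\mathtt{new\_consensus\_view}(v)$ (if it does), and $\mathbb E_{\rm first}(v),\mathbb E_{\rm last}(v)$ are the earliest/latest such times over correct processes. It is parameterized by a function $F$ from $\{0,1,2,\dots\}$ to durations which is monotone (non-decreasing), satisfies $F(0)=0$ and is unbounded: for every $\theta$ there is $v$ such that $F(v')>\theta$ for all $v'\ge v$. Each correct process eventually calls $\mathtt{start}()$ unless it gets a $\mathtt{new\_consensus\_view}$ notification first. Construction. On $\mathtt{start}()$: call $\mathtt{advance}()$. On $\mathtt{new\_view}(v)$ from the SMR synchronizer: stop $\mathsf{timer\_view}$;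 start $\mathsf{timer\_view}$ for duration $F(v)$ (measured by the local clock); trigger $\mathtt{new\_consensus\_view}(v)$. When $\mathsf{timer\_view}$ expires: call $\mathtt{advance}()$.
   Formalization: Local clocks, otherwise arbitrary before GST, are assumed to have bounded readings on bounded time intervals (true of every nondecreasing clock); otherwise infinitely many views could be entered before GST. Each correct process calls start() at most once. *)

theory Defs
  imports Complex_Main
begin

type_synonym time = real
type_synonym view = nat

text \<open>
  A table \<open>X :: 'p \<Rightarrow> view \<Rightarrow> time option\<close> records when process \<open>i\<close> does something in connection
  with view \<open>v\<close>; \<open>None\<close> means ``undefined''. Below, \<open>C\<close> is the (finite) set of correct processes,
  and \<open>E i v\<close>, \<open>A i v\<close> are the times \<open>E\<^sub>i(v)\<close>, \<open>A\<^sub>i(v)\<close>.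
\<close>

definition times_of :: "'p set \<Rightarrow> ('p \<Rightarrow> view \<Rightarrow> time option) \<Rightarrow> view \<Rightarrow> time set" where
  "times_of C X v = {t. \<exists>i\<in>C. X i v = Some t}"

definition first_of :: "'p set \<Rightarrow> ('p \<Rightarrow> view \<Rightarrow> time option) \<Rightarrow> view \<Rightarrow> time option" where
  "first_of C X v = (if times_of C X v = {} then None else Some (Min (times_of C X v)))"

definition last_of :: "'p set \<Rightarrow> ('p \<Rightarrow> view \<Rightarrow> time option) \<Rightarrow> view \<Rightarrow> time option" where
  "last_of C X v = (if times_of C X v = {} then None else Some (Max (times_of C X v)))"

definition monotonicity :: "'p set \<Rightarrow> ('p \<Rightarrow> view \<Rightarrow> time option) \<Rightarrow> bool" where
  "monotonicity C E \<longleftrightarrow>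
     (\<forall>i\<in>C. \<forall>v v' t t'. E i v = Some t \<and> E i v' = Some t' \<longrightarrow> (v < v' \<longleftrightarrow> t < t'))"

definition validity ::
  "'p set \<Rightarrow> ('p \<Rightarrow> view \<Rightarrow> time option) \<Rightarrow> ('p \<Rightarrow> view \<Rightarrow> time option) \<Rightarrow> bool" where
  "validity C E A \<longleftrightarrow>
     (\<forall>i\<in>C. \<forall>v t. E i (v + 1) = Some t \<longrightarrow> (\<exists>a. first_of C A v = Some a \<and> a < t))"

definition bounded_entry ::
  "'p set \<Rightarrow> ('p \<Rightarrow> view \<Rightarrow> time option) \<Rightarrow> ('p \<Rightarrow> view \<Rightarrow> time option) \<Rightarrow> time \<Rightarrow> bool" where
  "bounded_entry C E A d \<longleftrightarrow>
     (\<exists>V0\<ge>1. \<forall>v\<ge>V0. \<forall>t.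
        first_of C E v = Some t \<and> \<not> (\<exists>a. first_of C A v = Some a \<and> a < t + d) \<longrightarrow>
        (\<forall>i\<in>C. E i v \<noteq> None) \<and> (\<exists>l. last_of C E v = Some l \<and> l \<le> t + d))"

definition startup ::
  "'p set \<Rightarrow> nat \<Rightarrow> ('p \<Rightarrow> view \<Rightarrow> time option) \<Rightarrow> ('p \<Rightarrow> view \<Rightarrow> time option) \<Rightarrow> bool" where
  "startup C f E A \<longleftrightarrow>
     ((\<exists>P\<subseteq>C. card P = f + 1 \<and> (\<forall>i\<in>P. A i 0 \<noteq> None)) \<longrightarrow> first_of C E 1 \<noteq> None)"

definition progress ::
  "'p set \<Rightarrow> nat \<Rightarrow> ('p \<Rightarrow> view \<Rightarrow> time option) \<Rightarrow> ('p \<Rightarrow> view \<Rightarrow> time option) \<Rightarrow> bool" where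
  "progress C f E A \<longleftrightarrow>
     (\<forall>v. first_of C E v \<noteq> None \<and>
          (\<exists>P\<subseteq>C. card P = f + 1 \<and> (\<forall>i\<in>P. E i v \<noteq> None \<longrightarrow> A i v \<noteq> None)) \<longrightarrow>
          first_of C E (v + 1) \<noteq> None)"

definition smr_synchronizer_spec ::
  "'p set \<Rightarrow> nat \<Rightarrow> time \<Rightarrow> ('p \<Rightarrow> view \<Rightarrow> time option) \<Rightarrow> ('p \<Rightarrow> view \<Rightarrow> time option) \<Rightarrow> bool" where
  "smr_synchronizer_spec C f d E A \<longleftrightarrow>
     monotonicity C E \<and> validity C E A \<and> bounded_entry C E A d \<and> startup C f E A \<and> progress C f E A"

datatype event = Start | New_View view | Timer_Expires

datatype action = Advance | Stop_Timer | Start_Timer time | New_Consensus_View view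

fun handler :: "(view \<Rightarrow> time) \<Rightarrow> event \<Rightarrow> action list" where
  "handler F Start = [Advance]"
| "handler F (New_View v) = [Stop_Timer, Start_Timer (F v), New_Consensus_View v]"
| "handler F Timer_Expires = [Advance]"

text \<open>
  A local history is a sequence of steps, the \<open>k\<close>-th one taken at real time \<open>step_time h k\<close>. A step
  without event does nothing; such steps pad histories with only finitely many events. Events at
  the same instant are ordered by their step numbers.
\<close>

record history =
  step_time :: "nat \<Rightarrow> time"
  step_event :: "nat \<Rightarrow> event option"

definition actions :: "(view \<Rightarrow> time) \<Rightarrow> history \<Rightarrow> nat \<Rightarrow> action list" where
  "actions F h k = (case step_event h k of None \<Rightarrow> [] | Some e \<Rightarrow> handler F e)"

text \<open>The local state just before step \<open>k\<close>: the current view, and the timer, which is either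
  stopped (\<open>None\<close>) or was started at time \<open>s\<close> for duration \<open>D\<close> (\<open>Some (s, D)\<close>).\<close>

fun current_view :: "history \<Rightarrow> nat \<Rightarrow> view" where
  "current_view h 0 = 0"
| "current_view h (Suc k) =
     (case step_event h k of Some (New_View v) \<Rightarrow> v | _ \<Rightarrow> current_view h k)"

fun set_timer :: "time \<Rightarrow> action \<Rightarrow> (time \<times> time) option \<Rightarrow> (time \<times> time) option" where
  "set_timer t Stop_Timer T = None"
| "set_timer t (Start_Timer D) T = Some (t, D)"
| "set_timer t Advance T = T"
| "set_timer t (New_Consensus_View v) T = T"

fun timer_view :: "(view \<Rightarrow> time) \<Rightarrow> history \<Rightarrow> nat \<Rightarrow> (time \<times> time) option" where
  "timer_view F h 0 = None"
| "timer_view F h (Suc k) =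
     fold (set_timer (step_time h k)) (actions F h k)
       (if step_event h k = Some Timer_Expires then None else timer_view F h k)"

definition time_of_first :: "history \<Rightarrow> (nat \<Rightarrow> bool) \<Rightarrow> time option" where
  "time_of_first h Q = (if \<exists>k. Q k then Some (step_time h (LEAST k. Q k)) else None)"

definition entry_time :: "history \<Rightarrow> view \<Rightarrow> time option" where
  "entry_time h v = time_of_first h (\<lambda>k. step_event h k = Some (New_View v))"

definition advance_time :: "(view \<Rightarrow> time) \<Rightarrow> history \<Rightarrow> view \<Rightarrow> time option" where
  "advance_time F h v =
     time_of_first h (\<lambda>k. Advance \<in> set (actions F h k) \<and> current_view h k = v)"

definition consensus_entry_time :: "(view \<Rightarrow> time) \<Rightarrow> history \<Rightarrow> view \<Rightarrow> time option" where
  "consensus_entry_time F h v =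
     time_of_first h (\<lambda>k. New_Consensus_View v \<in> set (actions F h k))"

text \<open>
  \<open>c t\<close> is the reading of a local clock at real time \<open>t\<close>. Before \<open>GST\<close> the clock may run at any rate,
  jump, or even run backwards; it only cannot run off to infinity within bounded time (no
  nondecreasing clock does). Without the latter, timers of arbitrarily long durations could expire
  in ever shorter real time, and infinitely many views could be entered before \<open>GST\<close>.
\<close>

definition local_clock :: "time \<Rightarrow> (time \<Rightarrow> time) \<Rightarrow> bool" where
  "local_clock GST c \<longleftrightarrow>
     (\<forall>t\<ge>GST. c t - c GST = t - GST) \<and>
     (\<forall>a b. \<exists>B. \<forall>t\<in>{a..b}. \<bar>c t\<bar> \<le> B)"

text \<open>The first time at which \<open>D\<close> has elapsed on the clock \<open>c\<close> since \<open>s\<close>. It is an infimum because a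
  clock that jumps before \<open>GST\<close> need not attain the minimum.\<close>

definition expiry_time :: "(time \<Rightarrow> time) \<Rightarrow> time \<Rightarrow> time \<Rightarrow> time" where
  "expiry_time c s D = Inf {t. s \<le> t \<and> D \<le> c t - c s}"

text \<open>The last clause says that a running timer eventually expires unless it is stopped (only a
  new view does so), and that it is never overdue.\<close>

definition timer_correct :: "(view \<Rightarrow> time) \<Rightarrow> (time \<Rightarrow> time) \<Rightarrow> history \<Rightarrow> bool" where
  "timer_correct F c h \<longleftrightarrow>
     (\<forall>k. step_event h k = Some Timer_Expires \<longrightarrow>
        (\<exists>s D. timer_view F h k = Some (s, D) \<and> step_time h k = expiry_time c s D)) \<and>
     (\<forall>k s D. timer_view F h k = Some (s, D) \<longrightarrow>
        step_time h k \<le> expiry_time c s D \<and>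
        (\<exists>k'\<ge>k. step_event h k' = Some Timer_Expires \<or> (\<exists>v. step_event h k' = Some (New_View v))))"

text \<open>A process that was notified before calling \<open>start\<close> need not call it, but still may, once.\<close>

definition start_correct :: "(view \<Rightarrow> time) \<Rightarrow> history \<Rightarrow> bool" where
  "start_correct F h \<longleftrightarrow>
     (\<forall>k k'. step_event h k = Some Start \<and> step_event h k' = Some Start \<longrightarrow> k = k') \<and>
     ((\<exists>k. step_event h k = Some Start) \<or>
      (\<exists>k v. New_Consensus_View v \<in> set (actions F h k)))"

definition new_view_correct :: "history \<Rightarrow> bool" where
  "new_view_correct h \<longleftrightarrow>
     (\<forall>k v. step_event h k = Some (New_View v) \<longrightarrow> 1 \<le> v) \<and>
     (\<forall>k k' v. step_event h k = Some (New_View v) \<and> step_event h k' = Some (New_View v) \<longrightarrow> k = k')"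

definition consensus_synchronizer_history ::
  "(view \<Rightarrow> time) \<Rightarrow> (time \<Rightarrow> time) \<Rightarrow> history \<Rightarrow> bool" where
  "consensus_synchronizer_history F c h \<longleftrightarrow>
     mono (step_time h) \<and> new_view_correct h \<and> start_correct F h \<and> timer_correct F c h"

definition timeout_function :: "(view \<Rightarrow> time) \<Rightarrow> bool" where
  "timeout_function F \<longleftrightarrow> mono F \<and> F 0 = 0 \<and> (\<forall>\<theta>. \<exists>v. \<forall>v'\<ge>v. \<theta> < F v')"

end

theory Submission
  imports Defs
begin

text \<open>
  Every view is entered: by Validity an entered view is preceded by an entered one, and if a view
  were the last one entered, every timer started in it would expire and force Progress. A process
  starts at most once, so in all sufficiently high views a process advances only because its timer
  expires. Clocks are bounded on the bounded interval from the first entry to \<open>GST\<close> while \<open>F\<close> is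
  unbounded, so timers of high views cannot expire before \<open>GST\<close>; hence entry times eventually pass
  \<open>GST\<close>. From then on nobody advances from \<open>v\<close> earlier than \<open>F v\<close> after the first entry into \<open>v\<close>,
  which gives the gap between views by Validity and, once \<open>F v \<ge> d\<close>, discharges the premise of
  Bounded Entry.
\<close>

section \<open>Actions and entry times of a single history\<close>

lemma New_Consensus_View_in_actions_iff:
  "New_Consensus_View v \<in> set (actions F h k) \<longleftrightarrow> step_event h k = Some (New_View v)"
proof (cases "step_event h k")
  case (Some e)
  then show ?thesis by (cases e) (auto simp: actions_def)
qed (simp add: actions_def)

lemma Advance_in_actions_iff:
  "Advance \<in> set (actions F h k) \<longleftrightarrow>
     step_event h k = Some Start \<or> step_event h k = Some Timer_Expires"
proof (cases "step_event h k")
  case (Some e)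
  then show ?thesis by (cases e) (auto simp: actions_def)
qed (simp add: actions_def)

lemma consensus_entry_time_eq_entry_time: "consensus_entry_time F h v = entry_time h v"
  by (simp add: consensus_entry_time_def entry_time_def New_Consensus_View_in_actions_iff)

lemma time_of_first_SomeD:
  assumes "time_of_first h Q = Some t"
  obtains k where "Q k" "t = step_time h k"
  using assms by (auto simp: time_of_first_def split: if_splits intro: LeastI)

lemma time_of_first_eq_None_iff: "time_of_first h Q = None \<longleftrightarrow> (\<forall>k. \<not> Q k)"
  by (auto simp: time_of_first_def)

text \<open>Each view is notified at most once, so \<open>LEAST\<close> can only pick step
  \<open>k\<close>.\<close>

lemma entry_time_eq:
  assumes "new_view_correct h" "step_event h k = Some (New_View v)"
  shows "entry_time h v = Some (step_time h k)"
proof -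
  have "(LEAST k. step_event h k = Some (New_View v)) = k"
    using assms LeastI[of "\<lambda>k. step_event h k = Some (New_View v)" k]
    unfolding new_view_correct_def by blast
  then show ?thesis
    using assms(2) by (auto simp: entry_time_def time_of_first_def)
qed

section \<open>Local view, timer and advances\<close>

lemma current_view_entered:
  assumes "current_view h k \<noteq> 0"
  obtains j where "j < k" "step_event h j = Some (New_View (current_view h k))"
proof -
  have "current_view h k \<noteq> 0 \<Longrightarrow> \<exists>j<k. step_event h j = Some (New_View (current_view h k))"
  proof (induction k)
    case (Suc k)
    then show ?case
      by (auto simp: less_Suc_eq split: option.splits event.splits)
  qed simp
  with assms that show thesis by blast
qed

text \<open>\<open>New_View\<close> sets the view and restarts the timer in one step,
  \<open>Start\<close> changes neither, and an expiry clears the timer but keeps the view. So a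
  running timer always belongs to the current view.\<close>

lemma timer_view_SomeD:
  assumes "timer_view F h k = Some (s, D)"
  obtains j where "j < k" "step_event h j = Some (New_View (current_view h k))"
    "s = step_time h j" "D = F (current_view h k)"
proof -
  have "timer_view F h k = Some (s, D) \<Longrightarrow>
    \<exists>j<k. step_event h j = Some (New_View (current_view h k)) \<and>
      s = step_time h j \<and> D = F (current_view h k)"
  proof (induction k)
    case (Suc k)
    show ?case
    proof (cases "step_event h k")
      case None
      with Suc show ?thesis by (auto simp: actions_def less_Suc_eq)
    next
      case (Some e)
      with Suc show ?thesis by (cases e) (auto simp: actions_def less_Suc_eq)
    qed
  qed simp
  with assms that show thesis by blast
qed

lemma current_view_unchanged:
  assumes "j \<le> k" and "\<And>l v. j \<le> l \<Longrightarrow> l < k \<Longrightarrow> step_event h l \<noteq> Some (New_View v)"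
  shows "current_view h k = current_view h j"
  using assms
proof (induction k rule: dec_induct)
  case (step k)
  have "step_event h k \<noteq> Some (New_View v)" for v
    using step by simp
  moreover have "current_view h k = current_view h j"
    using step by simp
  ultimately show ?case
    by (simp split: option.split event.split)
qed simp

text \<open>Only \<open>Start\<close> and \<open>Timer_Expires\<close> cause an advance. The
  \<open>Start\<close> alternative remains in positive views because a process may still call
  \<open>start\<close> after its first notification.\<close>

lemma advance_time_cases:
  assumes h: "consensus_synchronizer_history F c h" and a: "advance_time F h v = Some a"
    and "v \<noteq> 0"
  obtains s where "entry_time h v = Some s" "s \<le> a"
    "a = expiry_time c s (F v) \<or> (\<exists>k. step_event h k = Some Start \<and> current_view h k = v)"
proof -
  from a obtain k where k: "Advance \<in> set (actions F h k)" "current_view h k = v"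
      "a = step_time h k"
    unfolding advance_time_def by (rule time_of_first_SomeD) blast
  obtain j where j: "j < k" "step_event h j = Some (New_View v)"
    using current_view_entered[of h k] k(2) \<open>v \<noteq> 0\<close> by metis
  have nvc: "new_view_correct h" and "mono (step_time h)" and tc: "timer_correct F c h"
    using h by (auto simp: consensus_synchronizer_history_def)
  then have entry: "entry_time h v = Some (step_time h j)" "step_time h j \<le> a"
    using j k(3) by (auto intro: entry_time_eq monoD)
  have "a = expiry_time c (step_time h j) (F v)" if "step_event h k = Some Timer_Expires"
  proof -
    obtain s D where sD: "timer_view F h k = Some (s, D)" "step_time h k = expiry_time c s D"
      using tc \<open>step_event h k = Some Timer_Expires\<close> unfolding timer_correct_def by blast
    \<comment> \<open>Step \<open>j'\<close> started the timer and \<open>j\<close> entered the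
      view; both have the unique entry time of \<open>v\<close>.\<close>
    obtain j' where "step_event h j' = Some (New_View v)" "s = step_time h j'" "D = F v"
      using timer_view_SomeD[OF sD(1)] k(2) by metis
    with entry(1) sD(2) nvc k(3) show ?thesis
      by (auto dest: entry_time_eq)
  qed
  with entry that k show thesis
    unfolding Advance_in_actions_iff by blast
qed

text \<open>The timer started on entering \<open>v\<close> can only be stopped by entering a higher view.\<close>

lemma advance_if_no_higher_entry:
  assumes h: "consensus_synchronizer_history F c h"
    and mon: "\<And>w w' t t'. entry_time h w = Some t \<Longrightarrow> entry_time h w' = Some t' \<Longrightarrow>
      w < w' \<longleftrightarrow> t < t'"
    and v: "entry_time h v \<noteq> None"
    and high: "\<And>w. w > v \<Longrightarrow> entry_time h w = None"
  shows "advance_time F h v \<noteq> None"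
proof -
  have nvc: "new_view_correct h" and "mono (step_time h)" and tc: "timer_correct F c h"
    using h by (auto simp: consensus_synchronizer_history_def)
  obtain j where j: "step_event h j = Some (New_View v)"
    using v by (auto simp: entry_time_def time_of_first_eq_None_iff)
  \<comment> \<open>Times do not decrease along steps, so Monotonicity excludes an entry into a view
    below \<open>v\<close>. Two steps may share an instant, hence \<open>w = v\<close> is excluded
    by uniqueness of the notification instead.\<close>
  have no_entry: "step_event h l \<noteq> Some (New_View w)" if "j < l" for l w
  proof
    assume l: "step_event h l = Some (New_View w)"
    have "entry_time h w = Some (step_time h l)" "entry_time h v = Some (step_time h j)"
      using nvc l j by (auto intro: entry_time_eq)
    moreover have "step_time h j \<le> step_time h l"
      using \<open>mono (step_time h)\<close> that by (simp add: monoD)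
    ultimately have "v \<le> w"
      using mon[of w _ v] by (metis not_less)
    moreover have "w \<noteq> v"
      using nvc l j that unfolding new_view_correct_def by blast
    ultimately show False
      using high[of w] \<open>entry_time h w = _\<close> by simp
  qed
  have "timer_view F h (Suc j) = Some (step_time h j, F v)"
    using j by (simp add: actions_def)
  then obtain k where k: "k \<ge> Suc j"
      "step_event h k = Some Timer_Expires \<or> (\<exists>w. step_event h k = Some (New_View w))"
    using tc unfolding timer_correct_def by blast
  then have "step_event h k = Some Timer_Expires"
    using no_entry[of k] by auto
  moreover have "current_view h k = v"
    using current_view_unchanged[of "Suc j" k h] k(1) no_entry j by simp
  ultimately show ?thesis
    by (auto simp: advance_time_def time_of_first_eq_None_iff Advance_in_actions_iff)
qed

section \<open>Expiry of timers on local clocks\<close>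

lemma expiry_time_after_GST:
  assumes "local_clock GST c" "GST \<le> s" "0 \<le> D"
  shows "expiry_time c s D = s + D"
proof -
  have "c t - c s = t - s" if "s \<le> t" for t
  proof -
    have "c t - c GST = t - GST" "c s - c GST = s - GST"
      using assms that by (auto simp: local_clock_def)
    then show ?thesis by simp
  qed
  \<comment> \<open>As \<open>0 \<le> D\<close>, the condition \<open>s \<le> t\<close> is implied
    by \<open>s + D \<le> t\<close>.\<close>
  then have "{t. s \<le> t \<and> D \<le> c t - c s} = {s + D..}"
    using assms(3) by (fastforce simp: set_eq_iff)
  then show ?thesis
    by (simp add: expiry_time_def)
qed

text \<open>The infimum need not be attained, but an infimum below \<open>GST\<close> of a nonempty
  set has a member below \<open>GST\<close>. Nonemptiness holds because the clock eventually follows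
  real time.\<close>

lemma expiry_time_less_GST:
  assumes c: "local_clock GST c" and less: "expiry_time c s D < GST"
  obtains t where "s \<le> t" "t < GST" "D \<le> c t - c s"
proof -
  \<comment> \<open>At or after \<open>GST\<close> the clock gains what real time gains, so at
    \<open>?t\<close> it reads at least \<open>c GST + \<bar>D + c s - c GST\<bar>\<close>, which is
    at least \<open>D + c s\<close>.\<close>
  let ?t = "max s (GST + \<bar>D + c s - c GST\<bar>)"
  have "c ?t - c GST = ?t - GST"
    using c by (auto simp: local_clock_def)
  then have "?t \<in> {t. s \<le> t \<and> D \<le> c t - c s}"
    by auto
  then have "{t. s \<le> t \<and> D \<le> c t - c s} \<noteq> {}"
    by blast
  from cInf_lessD[OF this less[unfolded expiry_time_def]] that show thesis
    by blast
qed

section \<open>First times over finitely many processes\<close>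

lemma finite_times_of: "finite C \<Longrightarrow> finite (times_of C X v)"
proof -
  assume "finite C"
  have "times_of C X v \<subseteq> (\<lambda>i. the (X i v)) ` C"
    by (force simp: times_of_def)
  with \<open>finite C\<close> show ?thesis
    by (meson finite_imageI finite_subset)
qed

lemma first_of_SomeD:
  assumes "finite C" "first_of C X v = Some t"
  obtains i where "i \<in> C" "X i v = Some t"
proof -
  have "t \<in> times_of C X v"
    using assms(2) Min_in[OF finite_times_of[OF assms(1)], of X v]
    by (simp add: first_of_def split: if_splits)
  with that show thesis
    by (auto simp: times_of_def)
qed

lemma first_of_le:
  assumes "finite C" "i \<in> C" "X i v = Some s"
  obtains t where "first_of C X v = Some t" "t \<le> s"
proof -
  have "s \<in> times_of C X v"
    using assms by (auto simp: times_of_def)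
  then have "first_of C X v = Some (Min (times_of C X v))" "Min (times_of C X v) \<le> s"
    using finite_times_of[OF assms(1), of X v] by (auto simp: first_of_def)
  with that show thesis by blast
qed

section \<open>Consequences of the SMR specification for the correct processes\<close>

locale consensus_synchronizer =
  fixes C :: "'p set"
    and f :: nat
    and GST d :: time
    and clock :: "'p \<Rightarrow> time \<Rightarrow> time"
    and F :: "view \<Rightarrow> time"
    and h :: "'p \<Rightarrow> history"
    and E A :: "'p \<Rightarrow> view \<Rightarrow> time option"
  defines "E \<equiv> (\<lambda>i. entry_time (h i))"
    and "A \<equiv> (\<lambda>i. advance_time F (h i))"
  assumes finite: "finite C"
    and card: "f + 1 \<le> card C"
    and F: "timeout_function F"
    and clock: "i \<in> C \<Longrightarrow> local_clock GST (clock i)"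
    and history: "i \<in> C \<Longrightarrow> consensus_synchronizer_history F (clock i) (h i)"
    and spec: "smr_synchronizer_spec C f d E A"
begin

lemma monotone_entry:
  "i \<in> C \<Longrightarrow> E i v = Some t \<Longrightarrow> E i v' = Some t' \<Longrightarrow> v < v' \<longleftrightarrow> t < t'"
  using spec unfolding smr_synchronizer_spec_def monotonicity_def by blast

lemma entry_preceded_by_advance:
  assumes "first_of C E (Suc v) = Some t"
  obtains a where "first_of C A v = Some a" "a < t"
proof -
  obtain i where "i \<in> C" "E i (v + 1) = Some t"
    using first_of_SomeD[OF finite assms] by auto
  then have "\<exists>a. first_of C A v = Some a \<and> a < t"
    using spec unfolding smr_synchronizer_spec_def validity_def by blast
  with that show thesis by blast
qed

lemma timeout_nonneg: "0 \<le> F v"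
  using F unfolding timeout_function_def by (metis le0 monoD)

text \<open>The process that is first to advance from \<open>v\<close> has itself entered
  \<open>v\<close> before, which links \<open>A\<close> back to the first entry into
  \<open>v\<close>.\<close>

lemma first_advance_cases:
  assumes "first_of C A v = Some a" "v \<noteq> 0"
  obtains i s t where "i \<in> C" "E i v = Some s" "s \<le> a" "first_of C E v = Some t" "t \<le> s"
    "a = expiry_time (clock i) s (F v) \<or>
      (\<exists>k. step_event (h i) k = Some Start \<and> current_view (h i) k = v)"
proof -
  obtain i where i: "i \<in> C" "A i v = Some a"
    using first_of_SomeD[OF finite assms(1)] by blast
  obtain s where s: "E i v = Some s" "s \<le> a"
      "a = expiry_time (clock i) s (F v) \<or>
        (\<exists>k. step_event (h i) k = Some Start \<and> current_view (h i) k = v)"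
    using advance_time_cases[OF history[OF i(1)], of v a] i(2) assms(2)
    unfolding A_def E_def by blast
  obtain t where "first_of C E v = Some t" "t \<le> s"
    using first_of_le[of C i E v s] finite i(1) s(1) by blast
  with i s that show thesis by blast
qed

section \<open>All views are entered\<close>

lemma previous_entered:
  assumes "first_of C E (Suc v) = Some t'" "v \<noteq> 0"
  obtains t where "first_of C E v = Some t" "t < t'"
proof -
  obtain a where a: "first_of C A v = Some a" "a < t'"
    using entry_preceded_by_advance[OF assms(1)] .
  obtain i s t where "s \<le> a" "first_of C E v = Some t" "t \<le> s"
    using first_advance_cases[OF a(1) assms(2)] .
  with a(2) that[of t] show thesis by simp
qed

lemma lower_entered:
  assumes "v \<le> w" "v \<noteq> 0" "first_of C E w \<noteq> None"
  shows "first_of C E v \<noteq> None"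
  using assms
proof (induction w rule: dec_induct)
  case (step w)
  then obtain t' where t': "first_of C E (Suc w) = Some t'" by auto
  have "w \<noteq> 0" using step by simp
  with t' obtain t where "first_of C E w = Some t"
    by (rule previous_entered)
  with step show ?case by simp
qed

lemma entered_if_entry:
  "i \<in> C \<Longrightarrow> E i v \<noteq> None \<Longrightarrow> first_of C E v \<noteq> None"
  using first_of_le[OF finite, of i E v] by (metis not_None_eq)

text \<open>Either some view is entered, and descending from it reaches view 1, or nobody is ever
  notified. In the latter case every correct process has to call \<open>start\<close>, does so in
  view 0, and Startup applies.\<close>

lemma entered_one: "first_of C E 1 \<noteq> None"
proof (cases "\<exists>i\<in>C. \<exists>v. E i v \<noteq> None")
  case True
  then obtain i v where i: "i \<in> C" "E i v \<noteq> None" by blast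
  then obtain k where "step_event (h i) k = Some (New_View v)"
    by (auto simp: E_def entry_time_def time_of_first_eq_None_iff)
  then have "1 \<le> v"
    using history[OF i(1)]
    by (auto simp: consensus_synchronizer_history_def new_view_correct_def)
  then show ?thesis
    using lower_entered[of 1 v] entered_if_entry[OF i] by simp
next
  case False
  have "A i 0 \<noteq> None" if "i \<in> C" for i
  proof -
    have no_view: "step_event (h i) k \<noteq> Some (New_View v)" for k v
      using False that by (auto simp: E_def entry_time_def time_of_first_eq_None_iff)
    then obtain k where "step_event (h i) k = Some Start"
      using history[OF \<open>i \<in> C\<close>]
      by (auto simp: consensus_synchronizer_history_def start_correct_def
          New_Consensus_View_in_actions_iff)
    moreover have "current_view (h i) k = 0"
      using current_view_unchanged[of 0 k "h i"] no_view by simp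
    ultimately show ?thesis
      by (auto simp: A_def advance_time_def time_of_first_eq_None_iff Advance_in_actions_iff)
  qed
  moreover obtain P where "P \<subseteq> C" "card P = f + 1"
    using card by (meson obtain_subset_with_card_n)
  ultimately have "\<exists>P\<subseteq>C. card P = f + 1 \<and> (\<forall>i\<in>P. A i 0 \<noteq> None)"
    by blast
  then show ?thesis
    using spec unfolding smr_synchronizer_spec_def startup_def by blast
qed

text \<open>If \<open>Suc v\<close> is not entered, no higher view is either. Then nothing stops the
  timers of \<open>v\<close>, so every correct process that entered \<open>v\<close> advances from
  it, contradicting Progress.\<close>

lemma next_entered:
  assumes "first_of C E v \<noteq> None"
  shows "first_of C E (Suc v) \<noteq> None"
proof
  assume none: "first_of C E (Suc v) = None"
  have high: "E i w = None" if "i \<in> C" "v < w" for i w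
    using lower_entered[of "Suc v" w] entered_if_entry[OF that(1), of w] none that(2)
    by fastforce
  have "A i v \<noteq> None" if "i \<in> C" "E i v \<noteq> None" for i
    using advance_if_no_higher_entry[OF history[OF that(1)]] monotone_entry[OF that(1)]
      high[OF that(1)] that(2)
    unfolding A_def E_def by blast
  \<comment> \<open>Any \<open>f + 1\<close> correct processes serve as the set in Progress.\<close>
  moreover obtain P where "P \<subseteq> C" "card P = f + 1"
    using card by (meson obtain_subset_with_card_n)
  ultimately have "\<exists>P\<subseteq>C. card P = f + 1 \<and> (\<forall>i\<in>P. E i v \<noteq> None \<longrightarrow> A i v \<noteq> None)"
    by blast
  then have "first_of C E (v + 1) \<noteq> None"
    using spec assms unfolding smr_synchronizer_spec_def progress_def by blast
  with none show False by simp
qed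

text \<open>A total version that allows arithmetic without options; meaningful from view 1 on by
  \<open>first_of_entry\<close>.\<close>

definition first_entry :: "view \<Rightarrow> time" where
  "first_entry v = the (first_of C E v)"

lemma first_of_entry:
  assumes "1 \<le> v"
  shows "first_of C E v = Some (first_entry v)"
proof -
  have "first_of C E v \<noteq> None"
    using assms
  proof (induction v rule: dec_induct)
    case base
    show ?case by (rule entered_one)
  next
    case (step v)
    then show ?case by (simp add: next_entered)
  qed
  then show ?thesis
    by (auto simp: first_entry_def)
qed

lemma first_entry_mono:
  assumes "1 \<le> v" "v \<le> w"
  shows "first_entry v \<le> first_entry w"
  using assms(2)
proof (induction w rule: dec_induct)
  case (step w)
  have "w \<noteq> 0" using step assms by simp
  then obtain t where "first_of C E w = Some t" "t < first_entry (Suc w)"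
    using previous_entered[OF first_of_entry[of "Suc w"]] by auto
  then have "first_entry w < first_entry (Suc w)"
    by (simp add: first_entry_def)
  with step show ?case by simp
qed simp

section \<open>Advances caused by timers only\<close>

text \<open>A late \<open>start\<close> could cause an advance before the timer of its view expires;
  this bounds the views in which that can happen.\<close>

definition no_start_from :: "view \<Rightarrow> bool" where
  "no_start_from V \<longleftrightarrow>
     (\<forall>i\<in>C. \<forall>k. step_event (h i) k = Some Start \<longrightarrow> current_view (h i) k < V)"

text \<open>Each correct process calls \<open>start\<close> at most once, hence in at most one view,
  and there are finitely many such processes.\<close>

lemma ex_no_start_from: "\<exists>V. no_start_from V"
proof -
  have "\<exists>V. \<forall>k. step_event (h i) k = Some Start \<longrightarrow> current_view (h i) k < V" if i: "i \<in> C" for i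
  proof (cases "\<exists>k. step_event (h i) k = Some Start")
    case True
    then obtain k where k: "step_event (h i) k = Some Start" ..
    have "k' = k" if "step_event (h i) k' = Some Start" for k'
      using history[OF i] k that
      unfolding consensus_synchronizer_history_def start_correct_def by blast
    then show ?thesis by blast
  qed simp
  then obtain V where V: "\<And>i k. i \<in> C \<Longrightarrow> step_event (h i) k = Some Start \<Longrightarrow>
      current_view (h i) k < V i"
    by metis
  have "V i \<le> Max (V ` C)" if "i \<in> C" for i
    using finite that by simp
  with V have "no_start_from (Max (V ` C))"
    unfolding no_start_from_def by (meson less_le_trans)
  then show ?thesis ..
qed

lemma first_advance_is_expiry:
  assumes "no_start_from V" "V \<le> v" "1 \<le> v" "first_of C A v = Some a"
  obtains i s where "i \<in> C" "first_entry v \<le> s" "a = expiry_time (clock i) s (F v)"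
proof -
  have "v \<noteq> 0" using assms(3) by simp
  from assms(4) this obtain i s t where "i \<in> C" "first_of C E v = Some t" "t \<le> s"
    "a = expiry_time (clock i) s (F v) \<or>
      (\<exists>k. step_event (h i) k = Some Start \<and> current_view (h i) k = v)"
    by (rule first_advance_cases)
  with assms first_of_entry[of v] that show thesis
    unfolding no_start_from_def by fastforce
qed

text \<open>The expiring timer was started at some \<open>s\<close> no earlier than
  \<open>first_entry v\<close>, hence after \<open>GST\<close>, where it runs for exactly
  \<open>F v\<close>.\<close>

lemma first_advance_after_GST:
  assumes "no_start_from V" "V \<le> v" "1 \<le> v" "GST \<le> first_entry v" "first_of C A v = Some a"
  shows "first_entry v + F v \<le> a"
proof -
  obtain i s where "i \<in> C" "first_entry v \<le> s" "a = expiry_time (clock i) s (F v)"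
    using first_advance_is_expiry[OF assms(1-3,5)] .
  with assms(4) expiry_time_after_GST[OF clock, of i s "F v"] timeout_nonneg[of v]
  show ?thesis by simp
qed

section \<open>Synchronization from some view on\<close>

lemma ex_first_entry_ge_GST: "\<exists>v\<ge>1. GST \<le> first_entry v"
proof (rule ccontr)
  assume "\<not> ?thesis"
  then have before: "first_entry v < GST" if "1 \<le> v" for v
    using that by (meson not_le)
  have "\<exists>B. \<forall>t\<in>{first_entry 1..GST}. \<bar>clock i t\<bar> \<le> B" if "i \<in> C" for i
    using clock[OF that] by (simp add: local_clock_def)
  then obtain B where B: "\<And>i t. i \<in> C \<Longrightarrow> first_entry 1 \<le> t \<Longrightarrow> t \<le> GST \<Longrightarrow>
      \<bar>clock i t\<bar> \<le> B i"
    by (metis atLeastAtMost_iff)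
  have B_le: "B i \<le> Max (B ` C)" if "i \<in> C" for i
    using finite that by simp
  obtain V where V: "no_start_from V"
    using ex_no_start_from ..
  obtain W where W: "\<And>v. v \<ge> W \<Longrightarrow> 2 * Max (B ` C) < F v"
    using F unfolding timeout_function_def by blast
  define v where "v = max 1 (max V W)"
  have v: "1 \<le> v" "V \<le> v" "W \<le> v"
    by (auto simp: v_def)
  obtain a where a: "first_of C A v = Some a" "a < first_entry (Suc v)"
    using entry_preceded_by_advance[OF first_of_entry[of "Suc v"]] by auto
  obtain i s where i: "i \<in> C" "first_entry v \<le> s" "a = expiry_time (clock i) s (F v)"
    using first_advance_is_expiry[OF V v(2,1) a(1)] .
  \<comment> \<open>The expiry is an advance that precedes the first entry into
    \<open>Suc v\<close>, which is assumed to lie before \<open>GST\<close>.\<close>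
  have "expiry_time (clock i) s (F v) < GST"
    using i(3) a(2) before[of "Suc v"] by simp
  then obtain t where t: "s \<le> t" "t < GST" "F v \<le> clock i t - clock i s"
    using expiry_time_less_GST[OF clock[OF i(1)]] by blast
  have "first_entry 1 \<le> s"
    using first_entry_mono[OF _ v(1)] i(2) by simp
  then have "\<bar>clock i t\<bar> \<le> B i" "\<bar>clock i s\<bar> \<le> B i"
    using B[OF i(1)] t by auto
  with t(3) B_le[OF i(1)] W[OF v(3)] show False
    by linarith
qed

theorem eventual_synchronization:
  obtains V where "1 \<le> V" "GST \<le> first_entry V"
    "\<And>i v. i \<in> C \<Longrightarrow> V \<le> v \<Longrightarrow> E i v \<noteq> None"
    "\<And>v. V \<le> v \<Longrightarrow> \<exists>l. last_of C E v = Some l \<and> l \<le> first_entry v + d"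
    "\<And>v. V \<le> v \<Longrightarrow> first_entry v + F v < first_entry (Suc v)"
proof -
  obtain S where S: "no_start_from S"
    using ex_no_start_from ..
  obtain G where G: "1 \<le> G" "GST \<le> first_entry G"
    using ex_first_entry_ge_GST by blast
  obtain D where D: "\<And>v. v \<ge> D \<Longrightarrow> d < F v"
    using F unfolding timeout_function_def by blast
  obtain V0 where V0: "\<And>v t. v \<ge> V0 \<Longrightarrow> first_of C E v = Some t \<Longrightarrow>
      \<not> (\<exists>a. first_of C A v = Some a \<and> a < t + d) \<Longrightarrow>
      (\<forall>i\<in>C. E i v \<noteq> None) \<and> (\<exists>l. last_of C E v = Some l \<and> l \<le> t + d)"
    using spec unfolding smr_synchronizer_spec_def bounded_entry_def by blast
  \<comment> \<open>From \<open>S\<close> on only timers cause advances, from \<open>G\<close> on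
    entries are past \<open>GST\<close>, from \<open>D\<close> on timers outlast \<open>d\<close>,
    and from \<open>V0\<close> on Bounded Entry applies.\<close>
  define V where "V = Max {S, G, D, V0}"
  have ge: "S \<le> V" "G \<le> V" "D \<le> V" "V0 \<le> V"
    by (auto simp: V_def)
  have GST: "GST \<le> first_entry v" if "V \<le> v" for v
    using first_entry_mono[OF G(1), of v] G(2) ge that by simp
  have advance: "first_entry v + F v \<le> a" if "V \<le> v" "first_of C A v = Some a" for v a
    using first_advance_after_GST[OF S _ _ GST that(2)] that(1) ge G(1) by simp
  have entry: "(\<forall>i\<in>C. E i v \<noteq> None) \<and> (\<exists>l. last_of C E v = Some l \<and> l \<le> first_entry v + d)"
    if v: "V \<le> v" for v
  proof (rule V0)
    show "V0 \<le> v" "first_of C E v = Some (first_entry v)"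
      using v ge G(1) by (auto intro: first_of_entry)
    \<comment> \<open>Any advance from \<open>v\<close> comes at least \<open>F v\<close>, hence
      more than \<open>d\<close>, after the first entry.\<close>
    show "\<not> (\<exists>a. first_of C A v = Some a \<and> a < first_entry v + d)"
      using advance[OF v] D[of v] ge v by force
  qed
  \<comment> \<open>Validity places an advance from \<open>v\<close> strictly before the first entry
    into \<open>Suc v\<close>.\<close>
  have gap: "first_entry v + F v < first_entry (Suc v)" if "V \<le> v" for v
  proof -
    obtain a where "first_of C A v = Some a" "a < first_entry (Suc v)"
      using entry_preceded_by_advance[OF first_of_entry[of "Suc v"]] by auto
    with advance[OF that] show ?thesis by fastforce
  qed
  show thesis
    by (rule that[of V]) (use G ge GST entry gap in auto)
qed

end

theorem theorem10:
  fixes procs correct :: "'p set"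
    and f :: nat
    and GST d :: time
    and clock :: "'p \<Rightarrow> time \<Rightarrow> time"
    and F :: "view \<Rightarrow> time"
    and h :: "'p \<Rightarrow> history"
  defines "E \<equiv> (\<lambda>i. entry_time (h i))"
    and "A \<equiv> (\<lambda>i. advance_time F (h i))"
    and "EC \<equiv> (\<lambda>i. consensus_entry_time F (h i))"
  assumes "finite procs" and "card procs = 3 * f + 1"
    and "correct \<subseteq> procs" and "card (procs - correct) \<le> f"
    and "timeout_function F"
    and "\<forall>i\<in>correct. local_clock GST (clock i)"
    and "\<forall>i\<in>correct. consensus_synchronizer_history F (clock i) (h i)"
    and "smr_synchronizer_spec correct f d E A"
  shows "\<exists>V\<ge>1.
      (\<forall>i\<in>correct. \<forall>v v' t t'. EC i v = Some t \<and> EC i v' = Some t' \<longrightarrow> (v < v' \<longleftrightarrow> t < t')) \<and>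
      (\<exists>t. first_of correct EC V = Some t \<and> t \<ge> GST) \<and>
      (\<forall>i\<in>correct. \<forall>v\<ge>V. EC i v \<noteq> None) \<and>
      (\<forall>v\<ge>V. \<exists>t l. first_of correct EC v = Some t \<and> last_of correct EC v = Some l \<and> l \<le> t + d) \<and>
      (\<forall>v\<ge>V. \<exists>t t'. first_of correct EC v = Some t \<and> first_of correct EC (v + 1) = Some t' \<and>
                t' > t + F v)"
proof -
  have fin: "finite correct"
    using assms(4,6) by (rule finite_subset[rotated])
  have "card (procs - correct) = card procs - card correct"
    using fin assms(6) by (rule card_Diff_subset)
  \<comment> \<open>Removing at most \<open>f\<close> of \<open>3 * f + 1\<close> processes leaves
    at least \<open>2 * f + 1\<close>.\<close>
  then have "f + 1 \<le> card correct"
    using assms(5,7) by simp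
  then interpret consensus_synchronizer correct f GST d clock F h E A
    unfolding E_def A_def
    by unfold_locales (use fin assms in \<open>auto simp: E_def A_def\<close>)
  \<comment> \<open>The handler triggers \<open>New_Consensus_View v\<close> in the very step that
    receives \<open>New_View v\<close>.\<close>
  have EC: "EC = E"
    by (simp add: EC_def E_def consensus_entry_time_eq_entry_time fun_eq_iff)
  obtain V where V: "1 \<le> V" "GST \<le> first_entry V"
    "\<And>i v. i \<in> correct \<Longrightarrow> V \<le> v \<Longrightarrow> E i v \<noteq> None"
    "\<And>v. V \<le> v \<Longrightarrow> \<exists>l. last_of correct E v = Some l \<and> l \<le> first_entry v + d"
    "\<And>v. V \<le> v \<Longrightarrow> first_entry v + F v < first_entry (Suc v)"
    using eventual_synchronization by blast
  have first: "first_of correct E v = Some (first_entry v)" if "V \<le> v" for v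
    using V(1) that by (intro first_of_entry) simp
  show ?thesis
    unfolding EC
  proof (intro exI[of _ V] conjI allI impI ballI)
    fix v assume "V \<le> v"
    with V(5) first[of v] first[of "Suc v"]
    show "\<exists>t t'. first_of correct E v = Some t \<and> first_of correct E (v + 1) = Some t' \<and>
        t' > t + F v"
      by simp
  qed (use V first monotone_entry in auto)
qed

end
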